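(* There exists a constant $\kappa_0>1$ such that the following holds. Let $f:\mathbb{R}^n\to\mathbb{R}$ and $g:\mathbb{R}^m\to\mathbb{R}$ satisfy $f\in\mathcal{S}(0,\beta_f)$ and $g\in\mathcal{S}(\mu_g,\beta_g)$ with $0<\mu_g\le\beta_g$ and $\beta_g/\mu_g\le\kappa_0$, and let $A\in\mathbb{R}^{m\times n}$ have full column rank. Let $$\gamma=\frac{\sqrt{\beta_g}-\sqrt{\mu_g}}{\sqrt{\beta_g}+\sqrt{\mu_g}},\qquad \eta_2=\frac{1}{\beta_g},$$ and consider the recursion, for $k\ge 0$, $$x^{k+1}=x^k-\eta_1\left(\nabla f(x^k)+A^Ty^k\right),$$ $$y^{k+1}=v^k-\eta_2\left(\nabla g(v^k)-Ax^k\right),\qquad v^{k+1}=(1+\gamma)y^{k+1}-\gamma y^k.$$ Then there exists a step size $\eta_1>0$ such that, for all initial conditions $x^0\in\mathbb{R}^n$, $y^0,v^0\in\mathbb{R}^m$, the sequences $\{x^k\}$ and $\{y^k\}$ converge exponentially to the primal and dual optimal solutions $x^\star$ and $y^\star$, respectively.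
   Context: For $\mu\ge 0$ and $\beta>0$, $\mathcal{S}(\mu,\beta)$ denotes the set of real-valued differentiable functions on a Euclidean space that are $\mu$-strongly convex and $\beta$-smooth (i.e. with $\beta$-Lipschitz gradient); $\mathcal{S}(0,\beta)$ denotes the set of convex $\beta$-smooth functions. The minimax problem is $\min_{x\in\mathbb{R}^n}\max_{y\in\mathbb{R}^m}L(x,y)$ with $L(x,y)=f(x)+y^TAx-g(y)$. The primal problem is to minimize $p(x)=\max_y L(x,y)$ over $x\in\mathbb{R}^n$; the dual problem is to maximize $d(y)=\min_x L(x,y)$ over $y\in\mathbb{R}^m$ (with $\min$ understood as infimum). Under the stated assumptions the primal and dual optimal solutions are unique; they are denoted $x^\star$ and $y^\star$. A sequence $\{z^k\}$ converges exponentially to $z^\star$ if there are $C\ge 0$ and $r\in[0,1)$ with $\|z^k-z^\star\|\le Cr^k$ for all $k\ge 0$. *)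

theory Defs
  imports
    "HOL-Library.Extended_Real"
    "Jordan_Normal_Form.DL_Rank"
begin

text \<open>
  The constant in the theorem must not depend on the dimensions, so \<open>n\<close> and \<open>m\<close> have to be
  quantified inside the formula.  Euclidean \<open>n\<close>-space is therefore \<open>carrier_vec n\<close> over the
  reals, and functions on it are given as functions of type \<open>real vec \<Rightarrow> real\<close> whose values
  outside \<open>carrier_vec n\<close> are irrelevant.
\<close>

definition vnorm :: "real vec \<Rightarrow> real" where
  "vnorm v = sqrt (v \<bullet> v)"

text \<open>\<open>d\<close> is the gradient of \<open>f\<close> at \<open>x\<close> in the sense of Frechet differentiability.\<close>

definition has_gradient :: "nat \<Rightarrow> (real vec \<Rightarrow> real) \<Rightarrow> real vec \<Rightarrow> real vec \<Rightarrow> bool" where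
  "has_gradient n f d x \<longleftrightarrow>
     d \<in> carrier_vec n \<and>
     (\<forall>e>0. \<exists>\<delta>>0. \<forall>z\<in>carrier_vec n. vnorm (z - x) < \<delta> \<longrightarrow>
        \<bar>f z - f x - d \<bullet> (z - x)\<bar> \<le> e * vnorm (z - x))"

definition differentiable_vec :: "nat \<Rightarrow> (real vec \<Rightarrow> real) \<Rightarrow> bool" where
  "differentiable_vec n f \<longleftrightarrow> (\<forall>x\<in>carrier_vec n. \<exists>d. has_gradient n f d x)"

definition grad :: "nat \<Rightarrow> (real vec \<Rightarrow> real) \<Rightarrow> real vec \<Rightarrow> real vec" where
  "grad n f x = (THE d. has_gradient n f d x)"

definition strongly_convex :: "nat \<Rightarrow> real \<Rightarrow> (real vec \<Rightarrow> real) \<Rightarrow> bool" where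
  "strongly_convex n \<mu> f \<longleftrightarrow>
     (\<forall>x\<in>carrier_vec n. \<forall>z\<in>carrier_vec n. \<forall>t. 0 \<le> t \<and> t \<le> 1 \<longrightarrow>
        f (t \<cdot>\<^sub>v x + (1 - t) \<cdot>\<^sub>v z)
          \<le> t * f x + (1 - t) * f z - \<mu> / 2 * t * (1 - t) * (vnorm (x - z))\<^sup>2)"

definition lipschitz_gradient :: "nat \<Rightarrow> real \<Rightarrow> (real vec \<Rightarrow> real) \<Rightarrow> bool" where
  "lipschitz_gradient n \<beta> f \<longleftrightarrow>
     (\<forall>x\<in>carrier_vec n. \<forall>z\<in>carrier_vec n.
        vnorm (grad n f x - grad n f z) \<le> \<beta> * vnorm (x - z))"

definition smooth_convex :: "nat \<Rightarrow> real \<Rightarrow> real \<Rightarrow> (real vec \<Rightarrow> real) set" where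
  "smooth_convex n \<mu> \<beta> =
     {f. differentiable_vec n f \<and> strongly_convex n \<mu> f \<and> lipschitz_gradient n \<beta> f}"

definition saddle ::
  "(real vec \<Rightarrow> real) \<Rightarrow> (real vec \<Rightarrow> real) \<Rightarrow> real mat \<Rightarrow> real vec \<Rightarrow> real vec \<Rightarrow> real" where
  "saddle f g A x y = f x + y \<bullet> (A *\<^sub>v x) - g y"

text \<open>The dual function may take the value \<open>-\<infinity>\<close>, hence the extended reals.\<close>

definition primal_fun ::
  "nat \<Rightarrow> (real vec \<Rightarrow> real) \<Rightarrow> (real vec \<Rightarrow> real) \<Rightarrow> real mat \<Rightarrow> real vec \<Rightarrow> ereal" where
  "primal_fun m f g A x = (SUP y\<in>carrier_vec m. ereal (saddle f g A x y))"

definition dual_fun ::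
  "nat \<Rightarrow> (real vec \<Rightarrow> real) \<Rightarrow> (real vec \<Rightarrow> real) \<Rightarrow> real mat \<Rightarrow> real vec \<Rightarrow> ereal" where
  "dual_fun n f g A y = (INF x\<in>carrier_vec n. ereal (saddle f g A x y))"

definition primal_opt ::
  "nat \<Rightarrow> nat \<Rightarrow> (real vec \<Rightarrow> real) \<Rightarrow> (real vec \<Rightarrow> real) \<Rightarrow> real mat \<Rightarrow> real vec \<Rightarrow> bool" where
  "primal_opt n m f g A x \<longleftrightarrow> is_arg_min (primal_fun m f g A) (\<lambda>x. x \<in> carrier_vec n) x"

definition dual_opt ::
  "nat \<Rightarrow> nat \<Rightarrow> (real vec \<Rightarrow> real) \<Rightarrow> (real vec \<Rightarrow> real) \<Rightarrow> real mat \<Rightarrow> real vec \<Rightarrow> bool" where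
  "dual_opt n m f g A y \<longleftrightarrow> is_arg_max (dual_fun n f g A) (\<lambda>y. y \<in> carrier_vec m) y"

definition converges_exponentially :: "(nat \<Rightarrow> real vec) \<Rightarrow> real vec \<Rightarrow> bool" where
  "converges_exponentially z l \<longleftrightarrow>
     (\<exists>C r. 0 \<le> C \<and> 0 \<le> r \<and> r < 1 \<and> (\<forall>k. vnorm (z k - l) \<le> C * r ^ k))"

end

theory Submission
  imports Defs "HOL-Analysis.L2_Norm"
begin

text \<open>
  Two time scales. For \<open>\<beta>g / \<mu>g\<close> close to 1, the \<open>y\<close>-iteration with \<open>x\<close> frozen contracts at a
  fixed rate towards the maximiser \<open>h x\<close> of \<open>L(x, \<cdot>)\<close>, because \<open>v - \<nabla>g(v) / \<beta>g\<close> is 1/2-Lipschitz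
  and the momentum is small. For small \<open>\<eta>1\<close>, the \<open>x\<close>-iteration is a slightly perturbed gradient
  descent on the primal function, whose gradient \<open>F x = \<nabla>f(x) + A\<^sup>T h(x)\<close> is Lipschitz and strongly
  monotone, and a weighted sum of \<open>|x - xs|\<close> and the tracking error of \<open>(y, v)\<close> decreases
  geometrically. The same contractions provide \<open>h x\<close> and the zero \<open>xs\<close> of \<open>F\<close> by Banach's theorem,
  and \<open>(xs, h xs)\<close> is a saddle point.
\<close>

subsection \<open>Euclidean geometry of \<open>carrier_vec\<close>\<close>

lemma scalar_prod_self_nonneg: "0 \<le> (v :: real vec) \<bullet> v"
  by (simp add: scalar_prod_def sum_nonneg)

lemma vnorm_nonneg [simp]: "0 \<le> vnorm v"
  by (simp add: vnorm_def scalar_prod_self_nonneg)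

lemma vnorm_power2: "(vnorm v)\<^sup>2 = v \<bullet> v"
  by (simp add: vnorm_def scalar_prod_self_nonneg)

lemma vnorm_eq_L2_set: "v \<in> carrier_vec n \<Longrightarrow> vnorm v = L2_set (($) v) {0..<n}"
  by (simp add: vnorm_def L2_set_def scalar_prod_def power2_eq_square)

lemma vnorm_zero [simp]: "vnorm (0\<^sub>v n) = 0"
  by (simp add: vnorm_def)

lemma vnorm_eq_0_iff: "v \<in> carrier_vec n \<Longrightarrow> vnorm v = 0 \<longleftrightarrow> v = 0\<^sub>v n"
  by (auto simp: vnorm_eq_L2_set L2_set_eq_0_iff intro!: eq_vecI)

lemma vnorm_diff_eq_0:
  "v \<in> carrier_vec n \<Longrightarrow> w \<in> carrier_vec n \<Longrightarrow> vnorm (v - w) = 0 \<longleftrightarrow> v = w"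
  by (auto simp: vnorm_eq_L2_set[of _ n] L2_set_eq_0_iff intro!: eq_vecI)

lemma vnorm_smult: "vnorm (a \<cdot>\<^sub>v v) = \<bar>a\<bar> * vnorm v"
  using scalar_prod_smult_left[of v v a] scalar_prod_smult_right[of "a \<cdot>\<^sub>v v" v a]
  by (simp add: vnorm_def real_sqrt_mult mult.assoc[symmetric])

lemma vnorm_minus_commute:
  "v \<in> carrier_vec n \<Longrightarrow> w \<in> carrier_vec n \<Longrightarrow> vnorm (v - w) = vnorm (w - v)"
  by (auto simp: vnorm_eq_L2_set[of _ n] L2_set_def power2_commute intro!: sum.cong)

lemma vnorm_add_le:
  assumes "v \<in> carrier_vec n" "w \<in> carrier_vec n"
  shows "vnorm (v + w) \<le> vnorm v + vnorm w"
proof -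
  have "L2_set (($) (v + w)) {0..<n} = L2_set (\<lambda>i. v $ i + w $ i) {0..<n}"
    using assms by (intro L2_set_cong) auto
  then show ?thesis
    using assms L2_set_triangle_ineq[of "($) v" "($) w" "{0..<n}"] by (simp add: vnorm_eq_L2_set[of _ n])
qed

lemma vnorm_triangle:
  assumes "u \<in> carrier_vec n" "v \<in> carrier_vec n" "w \<in> carrier_vec n"
  shows "vnorm (u - w) \<le> vnorm (u - v) + vnorm (v - w)"
proof -
  have "u - w = (u - v) + (v - w)"
    using assms by (intro eq_vecI) auto
  then show ?thesis
    using assms vnorm_add_le[of "u - v" n "v - w"] by simp
qed

lemma vnorm_diff_le:
  assumes "v \<in> carrier_vec n" "w \<in> carrier_vec n"
  shows "vnorm (v - w) \<le> vnorm v + vnorm w"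
proof -
  have "v - w = v + (-1) \<cdot>\<^sub>v w"
    using assms by (intro eq_vecI) auto
  then show ?thesis
    using assms vnorm_add_le[of v n "(-1) \<cdot>\<^sub>v w"] by (simp add: vnorm_smult)
qed

lemma scalar_prod_le_vnorm:
  assumes "v \<in> carrier_vec n" "w \<in> carrier_vec n"
  shows "\<bar>v \<bullet> w\<bar> \<le> vnorm v * vnorm w"
proof -
  have "\<bar>v \<bullet> w\<bar> \<le> (\<Sum>i\<in>{0..<n}. \<bar>v $ i\<bar> * \<bar>w $ i\<bar>)"
    using assms sum_abs[of "\<lambda>i. v $ i * w $ i" "{0..<n}"] by (simp add: scalar_prod_def abs_mult)
  also have "\<dots> \<le> L2_set (($) v) {0..<n} * L2_set (($) w) {0..<n}"
    by (rule L2_set_mult_ineq)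
  finally show ?thesis
    using assms by (simp add: vnorm_eq_L2_set[of _ n])
qed

lemma add_diff_add_vec:
  fixes a b c d :: "real vec"
  assumes "a \<in> carrier_vec n" "b \<in> carrier_vec n" "c \<in> carrier_vec n" "d \<in> carrier_vec n"
  shows "(a + b) - (c + d) = (a - c) + (b - d)"
  using assms by (intro eq_vecI) auto

lemma diff_of_steps:
  fixes a b p q :: "real vec"
  assumes "a \<in> carrier_vec n" "b \<in> carrier_vec n" "p \<in> carrier_vec n" "q \<in> carrier_vec n"
  shows "(a - t \<cdot>\<^sub>v p) - (b - t \<cdot>\<^sub>v q) = (a - b) - t \<cdot>\<^sub>v (p - q)"
  using assms by (intro eq_vecI) (auto simp: algebra_simps)

lemma diff_of_affine_steps:
  fixes a b p q r :: "real vec"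
  assumes "a \<in> carrier_vec n" "b \<in> carrier_vec n" "p \<in> carrier_vec n" "q \<in> carrier_vec n"
    "r \<in> carrier_vec n"
  shows "(a - t \<cdot>\<^sub>v (p - r)) - (b - t \<cdot>\<^sub>v (q - r)) = (a - b) - t \<cdot>\<^sub>v (p - q)"
  using assms by (intro eq_vecI) (auto simp: algebra_simps)

lemma add_add_diff_vec:
  fixes a b c :: "real vec"
  assumes "a \<in> carrier_vec n" "b \<in> carrier_vec n" "c \<in> carrier_vec n"
  shows "a + b = (a + c) + (b - c)"
  using assms by (intro eq_vecI) auto

lemma diff_right_commute_vec:
  fixes a b c :: "real vec"
  assumes "a \<in> carrier_vec n" "b \<in> carrier_vec n" "c \<in> carrier_vec n"
  shows "(a - b) - c = (a - c) - b"
  using assms by (intro eq_vecI) auto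

lemma diff_diff_step_vec:
  fixes a b :: "real vec"
  assumes "a \<in> carrier_vec n" "b \<in> carrier_vec n"
  shows "a - (a - b) = b"
  using assms by (intro eq_vecI) auto

lemma perturbed_step_diff:
  fixes a b p q :: "real vec"
  assumes "a \<in> carrier_vec n" "p \<in> carrier_vec n" "b \<in> carrier_vec n" "q \<in> carrier_vec n"
  shows "(a - t \<cdot>\<^sub>v (p + q)) - b = ((a - b) - t \<cdot>\<^sub>v (p - 0\<^sub>v n)) - t \<cdot>\<^sub>v q"
  using assms by (intro eq_vecI) (auto simp: algebra_simps)

lemma vnorm_diff_smult_power2:
  assumes "v \<in> carrier_vec n" "w \<in> carrier_vec n"
  shows "(vnorm (v - a \<cdot>\<^sub>v w))\<^sup>2 = (vnorm v)\<^sup>2 - 2 * a * (w \<bullet> v) + a\<^sup>2 * (vnorm w)\<^sup>2"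
proof -
  have "(vnorm (v - a \<cdot>\<^sub>v w))\<^sup>2 = v \<bullet> (v - a \<cdot>\<^sub>v w) - a * (w \<bullet> (v - a \<cdot>\<^sub>v w))"
    using assms by (simp add: vnorm_power2 minus_scalar_prod_distrib[of _ n])
  also have "\<dots> = (vnorm v)\<^sup>2 - 2 * a * (w \<bullet> v) + a\<^sup>2 * (vnorm w)\<^sup>2"
    using assms comm_scalar_prod[of v n w]
    unfolding vnorm_power2
    by (simp add: scalar_prod_minus_distrib[of _ n] algebra_simps power2_eq_square)
  finally show ?thesis .
qed

section \<open>Upper and lower bounds for a matrix as a linear map\<close>

lemma mult_mat_vec_bounded:
  assumes "A \<in> carrier_mat m n"
  obtains K where "K > 0" "\<And>v. v \<in> carrier_vec n \<Longrightarrow> vnorm (A *\<^sub>v v) \<le> K * vnorm v"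
proof
  \<comment> \<open>The summand 1 keeps the constant positive even for a zero matrix or for
    \<open>m = 0\<close>.\<close>
  let ?K = "1 + (\<Sum>i\<in>{0..<m}. vnorm (row A i))"
  have pos: "0 \<le> (\<Sum>i\<in>{0..<m}. vnorm (row A i))"
    by (simp add: sum_nonneg)
  then show "?K > 0" by simp
  fix v :: "real vec" assume v: "v \<in> carrier_vec n"
  have "vnorm (A *\<^sub>v v) \<le> (\<Sum>i\<in>{0..<m}. \<bar>(A *\<^sub>v v) $ i\<bar>)"
    using assms v by (simp only: vnorm_eq_L2_set[of _ m] mult_mat_vec_carrier L2_set_le_sum_abs)
  also have "\<dots> \<le> (\<Sum>i\<in>{0..<m}. vnorm (row A i) * vnorm v)"
    using assms v by (intro sum_mono) (auto intro!: scalar_prod_le_vnorm)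
  also have "\<dots> \<le> ?K * vnorm v"
    by (simp add: sum_distrib_right[symmetric] distrib_right)
  finally show "vnorm (A *\<^sub>v v) \<le> ?K * vnorm v" .
qed

text \<open>The Gram matrix of the columns is invertible, so its adjugate yields a left inverse of
  \<open>A\<close> up to a nonzero determinant factor. An upper bound for this left inverse becomes
  a lower bound for \<open>A\<close>.\<close>

lemma full_column_rank_bounded_below:
  assumes A: "A \<in> carrier_mat m n" and rank: "vec_space.rank m A = n"
  obtains \<sigma> where "\<sigma> > 0" "\<And>v. v \<in> carrier_vec n \<Longrightarrow> \<sigma> * vnorm v \<le> vnorm (A *\<^sub>v v)"
proof -
  interpret vec_space "TYPE(real)" m .
  \<comment> \<open>The rank is the size of a maximal independent subset of the set of columns; a
    repeated column would leave fewer than \<open>n\<close> of them.\<close>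
  have dist: "distinct (cols A)"
  proof -
    let ?P = "\<lambda>T. T \<subseteq> set (cols A) \<and> lin_indpt T"
    obtain S where S: "maximal S ?P"
      using maximal_exists[of ?P "card (set (cols A))" "{}"]
      by (meson List.finite_set card_mono empty_iff empty_subsetI finite_lin_indpt2 rev_finite_subset)
    have "length (cols A) = card S"
      using rank_card_indpt[OF A S] rank A by simp
    also have "\<dots> \<le> card (set (cols A))"
      using S by (simp add: card_mono maximal_def)
    finally show ?thesis
      using card_length[of "cols A"] by (intro card_distinct) simp
  qed
  have indpt: "lin_indpt (set (cols A))"
    using full_rank_lin_indpt[OF A rank dist] .
  have inj: "v = 0\<^sub>v n" if "v \<in> carrier_vec n" "A *\<^sub>v v = 0\<^sub>v m" for v
    using lin_depI[OF A that(1) _ that(2) dist] indpt by blast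
  define M where "M = transpose_mat A * A"
  have M: "M \<in> carrier_mat n n"
    using A by (simp add: M_def)
  have Mv: "M *\<^sub>v v = transpose_mat A *\<^sub>v (A *\<^sub>v v)" if "v \<in> carrier_vec n" for v
    using A that by (simp add: M_def)
  have det: "det M \<noteq> 0"
  proof
    assume "det M = 0"
    then obtain v where v: "v \<in> carrier_vec n" "v \<noteq> 0\<^sub>v n" "M *\<^sub>v v = 0\<^sub>v n"
      using det_0_iff_vec_prod_zero[OF M] by auto
    \<comment> \<open>The quadratic form of \<open>M\<close> is the squared length of the image
      under \<open>A\<close>, so a kernel vector of \<open>M\<close> is a kernel vector of
      \<open>A\<close>.\<close>
    have "(A *\<^sub>v v) \<bullet> (A *\<^sub>v v) = (M *\<^sub>v v) \<bullet> v"
      using transpose_vec_mult_scalar[OF A v(1), of "A *\<^sub>v v"] A v(1) by (simp add: Mv)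
    then have "vnorm (A *\<^sub>v v) = 0"
      using v by (simp add: vnorm_def)
    then show False
      using inj v A by (simp add: vnorm_eq_0_iff[of _ m])
  qed
  define B where "B = adj_mat M * transpose_mat A"
  have B: "B \<in> carrier_mat n m"
    using adj_mat[OF M] A by (simp add: B_def)
  obtain K where K: "K > 0" "\<And>v. v \<in> carrier_vec m \<Longrightarrow> vnorm (B *\<^sub>v v) \<le> K * vnorm v"
    using mult_mat_vec_bounded[OF B] by blast
  show thesis
  proof
    show "\<bar>det M\<bar> / K > 0" using det K by simp
    fix v :: "real vec" assume v: "v \<in> carrier_vec n"
    have "B *\<^sub>v (A *\<^sub>v v) = (adj_mat M * M) *\<^sub>v v"
      using A M v adj_mat(1)[OF M] by (simp add: B_def Mv assoc_mult_mat_vec[of _ n n _ n])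
    also have "\<dots> = det M \<cdot>\<^sub>v v"
      using adj_mat(3)[OF M] v by (auto intro!: eq_vecI)
    finally have "\<bar>det M\<bar> * vnorm v \<le> K * vnorm (A *\<^sub>v v)"
      using K(2)[of "A *\<^sub>v v"] A v by (simp add: vnorm_smult)
    then show "\<bar>det M\<bar> / K * vnorm v \<le> vnorm (A *\<^sub>v v)"
      using K(1) by (simp add: field_simps)
  qed
qed


section \<open>Banach's fixed point theorem\<close>

lemma contraction_has_fixpoint:
  fixes T :: "real vec \<Rightarrow> real vec"
  assumes T: "\<And>v. v \<in> carrier_vec n \<Longrightarrow> T v \<in> carrier_vec n"
    and q: "0 \<le> q" "q < 1"
    and contr: "\<And>v w. v \<in> carrier_vec n \<Longrightarrow> w \<in> carrier_vec n \<Longrightarrow>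
                  vnorm (T v - T w) \<le> q * vnorm (v - w)"
  obtains p where "p \<in> carrier_vec n" "T p = p"
proof -
  define z where "z k = (T ^^ k) (0\<^sub>v n)" for k
  have z: "z k \<in> carrier_vec n" for k
    by (induction k) (simp_all add: z_def T)
  have z_Suc: "z (Suc k) = T (z k)" for k
    by (simp add: z_def)
  have step: "vnorm (z (Suc k) - z k) \<le> vnorm (z 1 - z 0) * q ^ k" for k
  proof (induction k)
    case (Suc k)
    have "vnorm (z (Suc (Suc k)) - z (Suc k)) \<le> q * vnorm (z (Suc k) - z k)"
      using contr[OF z[of "Suc k"] z[of k]] by (simp only: z_Suc)
    also have "\<dots> \<le> q * (vnorm (z 1 - z 0) * q ^ k)"
      using Suc q(1) by (rule mult_left_mono)
    finally show ?case
      by (simp add: mult_ac)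
  qed simp
  \<comment> \<open>Completeness enters one coordinate at a time: the increments of a coordinate are
    dominated by a geometric series, and the coordinate is their telescoping sum.\<close>
  have conv: "convergent (\<lambda>k. z k $ i)" if i: "i < n" for i
  proof -
    have "summable (\<lambda>k. z (Suc k) $ i - z k $ i)"
    proof (rule summable_comparison_test')
      show "summable (\<lambda>k. vnorm (z 1 - z 0) * q ^ k)"
        using q by (intro summable_mult summable_geometric) simp
      fix k
      have "\<bar>(z (Suc k) - z k) $ i\<bar> \<le> vnorm (z (Suc k) - z k)"
        using i z member_le_L2_set[of "{0..<n}" i "\<lambda>i. \<bar>(z (Suc k) - z k) $ i\<bar>"]
        by (simp add: vnorm_eq_L2_set[of _ n] L2_set_def del: index_minus_vec)
      then show "norm (z (Suc k) $ i - z k $ i) \<le> vnorm (z 1 - z 0) * q ^ k"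
        using step[of k] i z by (simp add: carrier_vecD[OF z])
    qed
    then have "convergent (\<lambda>k. z 0 $ i + (\<Sum>j<k. z (Suc j) $ i - z j $ i))"
      by (intro convergent_add convergent_const) (simp add: summable_iff_convergent)
    then show ?thesis
      by (simp add: sum_lessThan_telescope[of "\<lambda>k. z k $ i"])
  qed
  define p where "p = vec n (\<lambda>i. lim (\<lambda>k. z k $ i))"
  have p: "p \<in> carrier_vec n"
    by (simp add: p_def)
  have lim: "(\<lambda>k. vnorm (z k - p)) \<longlonglongrightarrow> 0"
  proof (rule tendsto_sandwich[OF _ _ tendsto_const])
    show "\<forall>\<^sub>F k in sequentially. 0 \<le> vnorm (z k - p)"
      by simp
    show "\<forall>\<^sub>F k in sequentially. vnorm (z k - p) \<le> (\<Sum>i\<in>{0..<n}. \<bar>z k $ i - p $ i\<bar>)"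
    proof (intro always_eventually allI)
      fix k
      have "vnorm (z k - p) \<le> (\<Sum>i\<in>{0..<n}. \<bar>(z k - p) $ i\<bar>)"
        using z p by (simp only: vnorm_eq_L2_set[of _ n] minus_carrier_vec L2_set_le_sum_abs)
      also have "\<dots> = (\<Sum>i\<in>{0..<n}. \<bar>z k $ i - p $ i\<bar>)"
        using p by (intro sum.cong) auto
      finally show "vnorm (z k - p) \<le> (\<Sum>i\<in>{0..<n}. \<bar>z k $ i - p $ i\<bar>)" .
    qed
    have "(\<lambda>k. z k $ i) \<longlonglongrightarrow> p $ i" if "i < n" for i
      using conv[OF that] that by (simp add: p_def convergent_LIMSEQ_iff)
    then have "(\<lambda>k. \<Sum>i\<in>{0..<n}. \<bar>z k $ i - p $ i\<bar>) \<longlonglongrightarrow> (\<Sum>i\<in>{0..<n}. \<bar>p $ i - p $ i\<bar>)"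
      by (intro tendsto_intros) auto
    then show "(\<lambda>k. \<Sum>i\<in>{0..<n}. \<bar>z k $ i - p $ i\<bar>) \<longlonglongrightarrow> 0"
      by simp
  qed
  \<comment> \<open>The contraction property compares \<open>T p\<close> with
    \<open>T (z k)\<close>; both terms on the right tend to 0, which forces \<open>p\<close> to be
    fixed.\<close>
  have "vnorm (T p - p) \<le> q * vnorm (z k - p) + vnorm (z (Suc k) - p)" for k
    using vnorm_triangle[of "T p" n "T (z k)" p] contr[OF p z[of k]] T[OF p] T[OF z] p z
      vnorm_minus_commute[OF p z[of k]]
    by (simp add: z_Suc)
  moreover have "(\<lambda>k. q * vnorm (z k - p) + vnorm (z (Suc k) - p)) \<longlonglongrightarrow> q * 0 + 0"
    by (intro tendsto_intros lim LIMSEQ_Suc)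
  ultimately have "vnorm (T p - p) \<le> 0"
    using LIMSEQ_le_const[of _ "q * 0 + 0" "vnorm (T p - p)"] by auto
  then have "vnorm (T p - p) = 0"
    using vnorm_nonneg[of "T p - p"] by linarith
  then have "T p = p"
    using T[OF p] p by (simp add: vnorm_diff_eq_0[of _ n])
  with p show thesis
    by (rule that)
qed

subsection \<open>Gradients of convex functions\<close>

text \<open>In direction \<open>w = d - d'\<close> the two linear approximations differ by
  \<open>t * (vnorm w)\<^sup>2\<close>, while each is within \<open>e * t * vnorm w\<close> of the
  increment of \<open>f\<close>. Hence \<open>vnorm w\<close> is at most \<open>2 * e\<close> for
  every \<open>e > 0\<close>.\<close>

lemma has_gradient_unique:
  assumes x: "x \<in> carrier_vec n" and d: "has_gradient n f d x" and d': "has_gradient n f d' x"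
  shows "d = d'"
proof -
  have C: "d \<in> carrier_vec n" "d' \<in> carrier_vec n"
    using d d' by (auto simp: has_gradient_def)
  define w where "w = d - d'"
  have w: "w \<in> carrier_vec n"
    using C by (simp add: w_def)
  have "vnorm w \<le> 2 * e" if e: "e > 0" for e
  proof -
    obtain \<delta> where \<delta>: "\<delta> > 0" "\<And>z. z \<in> carrier_vec n \<Longrightarrow> vnorm (z - x) < \<delta> \<Longrightarrow>
        \<bar>f z - f x - d \<bullet> (z - x)\<bar> \<le> e * vnorm (z - x)"
      using d e unfolding has_gradient_def by blast
    obtain \<delta>' where \<delta>': "\<delta>' > 0" "\<And>z. z \<in> carrier_vec n \<Longrightarrow> vnorm (z - x) < \<delta>' \<Longrightarrow>
        \<bar>f z - f x - d' \<bullet> (z - x)\<bar> \<le> e * vnorm (z - x)"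
      using d' e unfolding has_gradient_def by blast
    \<comment> \<open>The 1 in the denominator makes the displacement strictly shorter than both
      radii and covers \<open>w = 0\<close>.\<close>
    define t where "t = min \<delta> \<delta>' / (vnorm w + 1)"
    have t: "t > 0"
      using \<delta>(1) \<delta>'(1) vnorm_nonneg[of w] by (simp add: t_def add_nonneg_pos)
    have tw: "t * vnorm w < min \<delta> \<delta>'"
      using \<delta>(1) \<delta>'(1) vnorm_nonneg[of w]
      by (simp add: t_def divide_less_eq add_nonneg_pos mult_less_cancel_left_pos
          del: min_less_iff_conj)
    define z where "z = x + t \<cdot>\<^sub>v w"
    have z: "z \<in> carrier_vec n" and zx: "z - x = t \<cdot>\<^sub>v w"
      using x w by (auto simp: z_def intro!: eq_vecI)
    have "t * (d \<bullet> w - d' \<bullet> w) \<le> 2 * e * (t * vnorm w)"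
      using \<delta>(2)[OF z] \<delta>'(2)[OF z] t tw C w unfolding zx vnorm_smult
      by (simp add: abs_le_iff algebra_simps)
    also have "d \<bullet> w - d' \<bullet> w = (vnorm w)\<^sup>2"
      using C w by (simp add: vnorm_power2 w_def minus_scalar_prod_distrib[of _ n])
    finally have "vnorm w * vnorm w \<le> 2 * e * vnorm w"
      using t by (simp add: power2_eq_square mult.left_commute[of _ t])
    then show ?thesis
      using e vnorm_nonneg[of w] by (cases "vnorm w = 0") auto
  qed
  \<comment> \<open>For nonzero \<open>w\<close> this choice of \<open>e\<close> would bound
    \<open>vnorm w\<close> by its own half.\<close>
  from this[of "vnorm w / 4"] have "vnorm w = 0"
    using vnorm_nonneg[of w] by (cases "vnorm w = 0") auto
  then show ?thesis
    using C by (simp add: w_def vnorm_diff_eq_0[of _ n])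
qed

lemma has_gradient_grad:
  assumes "differentiable_vec n f" "x \<in> carrier_vec n"
  shows "has_gradient n f (grad n f x) x"
proof -
  obtain d where "has_gradient n f d x"
    using assms by (auto simp: differentiable_vec_def)
  then show ?thesis
    unfolding grad_def by (rule theI) (use has_gradient_unique assms(2) \<open>has_gradient n f d x\<close> in blast)
qed

lemma grad_carrier:
  "differentiable_vec n f \<Longrightarrow> x \<in> carrier_vec n \<Longrightarrow> grad n f x \<in> carrier_vec n"
  using has_gradient_grad by (simp add: has_gradient_def)

text \<open>On the segment from \<open>v\<close> to \<open>u\<close>, strong convexity bounds
  \<open>f\<close> from above and differentiability bounds it from below. Dividing by the parameter
  \<open>t\<close> and letting it tend to 0 leaves the claim.\<close>

lemma strongly_convex_first_order:
  assumes f: "strongly_convex n \<mu> f" "differentiable_vec n f" and \<mu>: "0 \<le> \<mu>"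
    and u: "u \<in> carrier_vec n" and v: "v \<in> carrier_vec n"
  shows "f v + grad n f v \<bullet> (u - v) + \<mu> / 2 * (vnorm (u - v))\<^sup>2 \<le> f u"
proof -
  define w d c where "w = u - v" and "d = grad n f v" and "c = vnorm w + \<mu> / 2 * (vnorm w)\<^sup>2"
  have w: "w \<in> carrier_vec n"
    using u v by (simp add: w_def)
  have d: "has_gradient n f d v"
    using f(2) v by (simp add: d_def has_gradient_grad)
  then have d_carrier: "d \<in> carrier_vec n"
    by (simp add: has_gradient_def)
  have c: "0 \<le> c"
    using \<mu> by (simp add: c_def)
  have bound: "f v + d \<bullet> w + \<mu> / 2 * (vnorm w)\<^sup>2 \<le> f u + e * c" if e: "e > 0" for e
  proof -
    obtain \<delta> where \<delta>: "\<delta> > 0" "\<And>z. z \<in> carrier_vec n \<Longrightarrow> vnorm (z - v) < \<delta> \<Longrightarrow>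
        \<bar>f z - f v - d \<bullet> (z - v)\<bar> \<le> e * vnorm (z - v)"
      using d e unfolding has_gradient_def by blast
    \<comment> \<open>The bound \<open>t \<le> e\<close> controls the loss from the factor
      \<open>1 - t\<close> in the quadratic term; together with the error of the linear
      approximation the total is \<open>e * c\<close>.\<close>
    define t where "t = min (min 1 e) (\<delta> / (vnorm w + 1))"
    have t: "0 < t" "t \<le> 1" "t \<le> e" "t \<le> \<delta> / (vnorm w + 1)"
      using \<delta>(1) e vnorm_nonneg[of w] by (auto simp: t_def add_nonneg_pos)
    then have "t * (vnorm w + 1) \<le> \<delta>"
      using vnorm_nonneg[of w] by (simp add: pos_le_divide_eq add_nonneg_pos)
    then have tw: "t * vnorm w < \<delta>"
      using t(1) by (simp add: algebra_simps)
    define z where "z = t \<cdot>\<^sub>v u + (1 - t) \<cdot>\<^sub>v v"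
    have z: "z \<in> carrier_vec n" and zv: "z - v = t \<cdot>\<^sub>v w"
      using u v by (auto simp: z_def w_def algebra_simps intro!: eq_vecI)
    have "f z \<le> t * f u + (1 - t) * f v - \<mu> / 2 * t * (1 - t) * (vnorm w)\<^sup>2"
      using f(1) u v t unfolding strongly_convex_def z_def w_def by auto
    moreover have "f v + t * (d \<bullet> w) - e * (t * vnorm w) \<le> f z"
      using \<delta>(2)[OF z] t tw d_carrier w unfolding zv vnorm_smult by (simp add: abs_le_iff)
    ultimately have "t * (f v + d \<bullet> w + \<mu> / 2 * (1 - t) * (vnorm w)\<^sup>2) \<le> t * (f u + e * vnorm w)"
      by (simp add: algebra_simps)
    then have "f v + d \<bullet> w + \<mu> / 2 * (1 - t) * (vnorm w)\<^sup>2 \<le> f u + e * vnorm w"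
      using t(1) by simp
    moreover have "t * (\<mu> / 2 * (vnorm w)\<^sup>2) \<le> e * (\<mu> / 2 * (vnorm w)\<^sup>2)"
      using t \<mu> by (intro mult_right_mono) auto
    ultimately show ?thesis
      by (simp add: c_def algebra_simps add_divide_distrib diff_divide_distrib)
  qed
  have "f v + d \<bullet> w + \<mu> / 2 * (vnorm w)\<^sup>2 \<le> f u"
  proof (rule field_le_epsilon)
    fix e :: real assume "e > 0"
    \<comment> \<open>Dividing by \<open>c + 1\<close> instead of \<open>c\<close> covers
      \<open>u = v\<close>, where \<open>c = 0\<close>.\<close>
    then have "f v + d \<bullet> w + \<mu> / 2 * (vnorm w)\<^sup>2 \<le> f u + e / (c + 1) * c"
      using c by (intro bound) (simp add: add_nonneg_pos)
    also have "e / (c + 1) * c \<le> e"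
      using c \<open>e > 0\<close> by (simp add: pos_divide_le_eq add_nonneg_pos algebra_simps)
    finally show "f v + d \<bullet> w + \<mu> / 2 * (vnorm w)\<^sup>2 \<le> f u + e"
      by simp
  qed
  then show ?thesis
    by (simp add: w_def d_def)
qed

text \<open>Adding the first-order inequalities for \<open>(u, v)\<close> and \<open>(v, u)\<close>
  cancels the function values.\<close>

lemma grad_strongly_monotone:
  assumes f: "strongly_convex n \<mu> f" "differentiable_vec n f" and \<mu>: "0 \<le> \<mu>"
    and u: "u \<in> carrier_vec n" and v: "v \<in> carrier_vec n"
  shows "\<mu> * (vnorm (u - v))\<^sup>2 \<le> (grad n f u - grad n f v) \<bullet> (u - v)"
proof -
  have C: "grad n f u \<in> carrier_vec n" "grad n f v \<in> carrier_vec n"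
    using f u v by (auto intro: grad_carrier)
  have "v - u = - (u - v)"
    using u v by (intro eq_vecI) auto
  then have "grad n f u \<bullet> (v - u) = - (grad n f u \<bullet> (u - v))"
    using C u v by simp
  then show ?thesis
    using strongly_convex_first_order[OF f \<mu> u v] strongly_convex_first_order[OF f \<mu> v u]
      minus_scalar_prod_distrib[OF C, of "u - v"] vnorm_minus_commute[OF u v] u v
    by simp
qed

subsection \<open>The saddle point problem\<close>

text \<open>The assumption \<open>well_conditioned\<close> is \<beta> / \<mu> \<le> 8 / 7 without
  division. This is the largest ratio for which the estimate in
  \<open>gradient_step_half_lipschitz\<close> yields the factor 1/2.\<close>

locale bilinear_saddle =
  fixes n m :: nat and f g :: "real vec \<Rightarrow> real" and A :: "real mat" and \<beta>f \<mu> \<beta> :: real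
  assumes \<beta>f_pos: "0 < \<beta>f" and f_class: "f \<in> smooth_convex n 0 \<beta>f"
    and \<mu>_pos: "0 < \<mu>" and \<mu>_le_\<beta>: "\<mu> \<le> \<beta>" and well_conditioned: "7 * \<beta> \<le> 8 * \<mu>"
    and g_class: "g \<in> smooth_convex m \<mu> \<beta>"
    and A: "A \<in> carrier_mat m n" and A_rank: "vec_space.rank m A = n"
begin

lemma \<beta>_pos: "0 < \<beta>"
  using \<mu>_pos \<mu>_le_\<beta> by simp

lemma f: "strongly_convex n 0 f" "differentiable_vec n f" "lipschitz_gradient n \<beta>f f"
  using f_class by (auto simp: smooth_convex_def)

lemma g: "strongly_convex m \<mu> g" "differentiable_vec m g" "lipschitz_gradient m \<beta> g"
  using g_class by (auto simp: smooth_convex_def)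

lemma grad_f_carrier [simp]: "x \<in> carrier_vec n \<Longrightarrow> grad n f x \<in> carrier_vec n"
  using f(2) by (rule grad_carrier)

lemma grad_g_carrier [simp]: "y \<in> carrier_vec m \<Longrightarrow> grad m g y \<in> carrier_vec m"
  using g(2) by (rule grad_carrier)

lemma A_carrier [simp]: "x \<in> carrier_vec n \<Longrightarrow> A *\<^sub>v x \<in> carrier_vec m"
  using A by simp

lemma At_carrier [simp]: "y \<in> carrier_vec m \<Longrightarrow> transpose_mat A *\<^sub>v y \<in> carrier_vec n"
  using A by (metis mult_mat_vec_carrier transpose_carrier_mat)

lemma A_diff: "x \<in> carrier_vec n \<Longrightarrow> x' \<in> carrier_vec n \<Longrightarrow> A *\<^sub>v (x - x') = A *\<^sub>v x - A *\<^sub>v x'"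
  using A by (rule mult_minus_distrib_mat_vec)

lemma At_diff:
  "y \<in> carrier_vec m \<Longrightarrow> y' \<in> carrier_vec m \<Longrightarrow>
    transpose_mat A *\<^sub>v (y - y') = transpose_mat A *\<^sub>v y - transpose_mat A *\<^sub>v y'"
  using A by (intro mult_minus_distrib_mat_vec) auto

lemma At_scalar_prod:
  "x \<in> carrier_vec n \<Longrightarrow> y \<in> carrier_vec m \<Longrightarrow> (transpose_mat A *\<^sub>v y) \<bullet> x = y \<bullet> (A *\<^sub>v x)"
  using transpose_vec_mult_scalar[OF A] comm_scalar_prod[of y m "A *\<^sub>v x"]
    comm_scalar_prod[of x n "transpose_mat A *\<^sub>v y"] by simp

section \<open>The inner maximisation over y\<close>

lemma gradient_step_half_lipschitz:
  assumes u: "u \<in> carrier_vec m" and v: "v \<in> carrier_vec m"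
  shows "vnorm ((u - v) - (1 / \<beta>) \<cdot>\<^sub>v (grad m g u - grad m g v)) \<le> 1 / 2 * vnorm (u - v)"
proof (rule power2_le_imp_le)
  let ?D = "grad m g u - grad m g v"
  have "vnorm ?D \<le> \<beta> * vnorm (u - v)"
    using g(3) u v by (auto simp: lipschitz_gradient_def)
  then have "(vnorm ?D)\<^sup>2 \<le> (\<beta> * vnorm (u - v))\<^sup>2"
    by (intro power_mono) auto
  then have lip: "(1 / \<beta>)\<^sup>2 * (vnorm ?D)\<^sup>2 \<le> (vnorm (u - v))\<^sup>2"
    using \<beta>_pos by (simp add: power_mult_distrib field_simps)
  have "7 / 8 * (vnorm (u - v))\<^sup>2 \<le> \<mu> / \<beta> * (vnorm (u - v))\<^sup>2"
    using well_conditioned \<beta>_pos by (intro mult_right_mono) (auto simp: field_simps)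
  also have "\<dots> \<le> 1 / \<beta> * (?D \<bullet> (u - v))"
    using grad_strongly_monotone[OF g(1,2) _ u v] \<mu>_pos \<beta>_pos by (simp add: divide_right_mono)
  finally have mono: "7 / 8 * (vnorm (u - v))\<^sup>2 \<le> 1 / \<beta> * (?D \<bullet> (u - v))" .
  have "(vnorm ((u - v) - (1 / \<beta>) \<cdot>\<^sub>v ?D))\<^sup>2 =
      (vnorm (u - v))\<^sup>2 - 2 * (1 / \<beta> * (?D \<bullet> (u - v))) + (1 / \<beta>)\<^sup>2 * (vnorm ?D)\<^sup>2"
    using u v by (simp add: vnorm_diff_smult_power2[of _ m])
  \<comment> \<open>The coefficients add up to 1 - 2 * 7/8 + 1 = 1/4.\<close>
  also have "\<dots> \<le> 1 / 4 * (vnorm (u - v))\<^sup>2"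
    using mono lip by linarith
  also have "\<dots> = (1 / 2 * vnorm (u - v))\<^sup>2"
    by (simp add: power_mult_distrib power_divide)
  finally show "(vnorm ((u - v) - (1 / \<beta>) \<cdot>\<^sub>v ?D))\<^sup>2 \<le> (1 / 2 * vnorm (u - v))\<^sup>2" .
qed simp

text \<open>For frozen \<open>x\<close>, the shift by \<open>A *\<^sub>v x\<close> cancels in
  differences, so the gradient step for \<open>g\<close> with this linear term removed is still a
  contraction. Its fixed point solves the equation.\<close>

lemma inner_solution_exists:
  assumes x: "x \<in> carrier_vec n"
  shows "\<exists>y\<in>carrier_vec m. grad m g y = A *\<^sub>v x"
proof -
  define T where "T y = y - (1 / \<beta>) \<cdot>\<^sub>v (grad m g y - A *\<^sub>v x)" for y
  have T: "T y \<in> carrier_vec m" if "y \<in> carrier_vec m" for y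
    using that x by (simp add: T_def)
  have "vnorm (T y - T y') \<le> 1 / 2 * vnorm (y - y')"
    if y: "y \<in> carrier_vec m" "y' \<in> carrier_vec m" for y y'
  proof -
    have "T y - T y' = (y - y') - (1 / \<beta>) \<cdot>\<^sub>v (grad m g y - grad m g y')"
      unfolding T_def using y x by (intro diff_of_affine_steps[of _ m]) auto
    then show ?thesis
      using gradient_step_half_lipschitz[OF y] by simp
  qed
  then obtain y where y: "y \<in> carrier_vec m" "T y = y"
    using contraction_has_fixpoint[of m T "1 / 2"] T by auto
  have "grad m g y = A *\<^sub>v x"
  proof (intro eq_vecI)
    show "dim_vec (grad m g y) = dim_vec (A *\<^sub>v x)"
      using carrier_vecD[OF grad_g_carrier[OF y(1)]] A by simp
    fix i assume "i < dim_vec (A *\<^sub>v x)"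
    then have i: "i < m" using A by simp
    have "T y $ i = y $ i"
      using y(2) by simp
    then show "grad m g y $ i = (A *\<^sub>v x) $ i"
      using i y(1) x A \<beta>_pos unfolding T_def by (simp add: carrier_vecD[OF grad_g_carrier[OF y(1)]])
  qed
  with y(1) show ?thesis by blast
qed

text \<open>This is the gradient of the convex conjugate of \<open>g\<close>, evaluated at
  \<open>A *\<^sub>v x\<close>. The choice is unambiguous because the gradient of \<open>g\<close>
  is strongly monotone, hence injective.\<close>

definition h :: "real vec \<Rightarrow> real vec" where
  "h x = (SOME y. y \<in> carrier_vec m \<and> grad m g y = A *\<^sub>v x)"

lemma h_carrier [simp]: "x \<in> carrier_vec n \<Longrightarrow> h x \<in> carrier_vec m"
  and grad_h: "x \<in> carrier_vec n \<Longrightarrow> grad m g (h x) = A *\<^sub>v x"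
  using someI_ex[of "\<lambda>y. y \<in> carrier_vec m \<and> grad m g y = A *\<^sub>v x"] inner_solution_exists[of x]
  by (auto simp: h_def)

text \<open>Strong monotonicity of the gradient of \<open>g\<close>, read through its inverse. With
  Cauchy-Schwarz it makes \<open>h\<close> Lipschitz, and it is the source of the strong
  monotonicity of \<open>F\<close>.\<close>

lemma h_strongly_monotone:
  assumes "x \<in> carrier_vec n" "x' \<in> carrier_vec n"
  shows "\<mu> * (vnorm (h x - h x'))\<^sup>2 \<le> (A *\<^sub>v x - A *\<^sub>v x') \<bullet> (h x - h x')"
  using grad_strongly_monotone[OF g(1,2) less_imp_le[OF \<mu>_pos], of "h x" "h x'"] assms
  by (simp add: grad_h)

lemma h_lipschitz:
  obtains l where "l > 0"
    "\<And>x x'. x \<in> carrier_vec n \<Longrightarrow> x' \<in> carrier_vec n \<Longrightarrow> vnorm (h x - h x') \<le> l * vnorm (x - x')"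
proof -
  obtain a where a: "a > 0" "\<And>x. x \<in> carrier_vec n \<Longrightarrow> vnorm (A *\<^sub>v x) \<le> a * vnorm x"
    using mult_mat_vec_bounded[OF A] by blast
  show thesis
  proof
    show "a / \<mu> > 0" using a \<mu>_pos by simp
    fix x x' :: "real vec" assume x: "x \<in> carrier_vec n" "x' \<in> carrier_vec n"
    let ?N = "vnorm (h x - h x')"
    have "\<mu> * ?N\<^sup>2 \<le> vnorm (A *\<^sub>v x - A *\<^sub>v x') * ?N"
      using h_strongly_monotone[OF x] scalar_prod_le_vnorm[of "A *\<^sub>v x - A *\<^sub>v x'" m "h x - h x'"] x
      by simp
    also have "\<dots> \<le> a * vnorm (x - x') * ?N"
      using a(2)[of "x - x'"] x by (intro mult_right_mono) (auto simp: A_diff)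
    finally have "\<mu> * ?N \<le> a * vnorm (x - x')"
      using a(1) by (cases "?N = 0") (auto simp: power2_eq_square less_le)
    then show "?N \<le> a / \<mu> * vnorm (x - x')"
      using \<mu>_pos by (simp add: field_simps)
  qed
qed

section \<open>The gradient of the primal function\<close>

text \<open>The formula is Danskin's theorem: the y-derivative vanishes at the maximiser
  \<open>h x\<close>, so only the partial derivative in x remains.\<close>

definition F :: "real vec \<Rightarrow> real vec" where
  "F x = grad n f x + transpose_mat A *\<^sub>v h x"

lemma F_carrier [simp]: "x \<in> carrier_vec n \<Longrightarrow> F x \<in> carrier_vec n"
  by (simp add: F_def)

lemma F_diff:
  assumes x: "x \<in> carrier_vec n" "x' \<in> carrier_vec n"
  shows "F x - F x' = (grad n f x - grad n f x') + transpose_mat A *\<^sub>v (h x - h x')"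
  unfolding F_def At_diff[OF h_carrier[OF x(1)] h_carrier[OF x(2)]]
  using x by (intro add_diff_add_vec[of _ n]) auto

lemma F_lipschitz:
  obtains L where "L > 0"
    "\<And>x x'. x \<in> carrier_vec n \<Longrightarrow> x' \<in> carrier_vec n \<Longrightarrow> vnorm (F x - F x') \<le> L * vnorm (x - x')"
proof -
  obtain a where a: "a > 0" "\<And>y. y \<in> carrier_vec m \<Longrightarrow> vnorm (transpose_mat A *\<^sub>v y) \<le> a * vnorm y"
    using mult_mat_vec_bounded[of "transpose_mat A" n m] A by auto
  obtain l where l: "l > 0"
    "\<And>x x'. x \<in> carrier_vec n \<Longrightarrow> x' \<in> carrier_vec n \<Longrightarrow> vnorm (h x - h x') \<le> l * vnorm (x - x')"
    using h_lipschitz by blast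
  show thesis
  proof
    show "\<beta>f + a * l > 0" using \<beta>f_pos a l by (simp add: add_pos_pos)
    fix x x' :: "real vec" assume x: "x \<in> carrier_vec n" "x' \<in> carrier_vec n"
    have "vnorm (F x - F x') \<le> vnorm (grad n f x - grad n f x') + vnorm (transpose_mat A *\<^sub>v (h x - h x'))"
      unfolding F_diff[OF x] using x by (intro vnorm_add_le[of _ n]) auto
    also have "vnorm (grad n f x - grad n f x') \<le> \<beta>f * vnorm (x - x')"
      using f(3) x by (auto simp: lipschitz_gradient_def)
    also have "vnorm (transpose_mat A *\<^sub>v (h x - h x')) \<le> a * vnorm (h x - h x')"
      using x by (intro a(2)) auto
    also have "\<dots> \<le> a * (l * vnorm (x - x'))"
      using l(2)[OF x] a(1) by (intro mult_left_mono) auto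
    finally show "vnorm (F x - F x') \<le> (\<beta>f + a * l) * vnorm (x - x')"
      by (simp add: algebra_simps)
  qed
qed

text \<open>Strong convexity of the primal function comes from the dual side only: \<open>h\<close> inverts the
  strongly monotone Lipschitz map \<open>grad m g\<close>, and \<open>A\<close> is bounded below.\<close>

lemma F_strongly_monotone:
  obtains c where "c > 0"
    "\<And>x x'. x \<in> carrier_vec n \<Longrightarrow> x' \<in> carrier_vec n \<Longrightarrow>
       c * (vnorm (x - x'))\<^sup>2 \<le> (F x - F x') \<bullet> (x - x')"
proof -
  obtain \<sigma> where \<sigma>: "\<sigma> > 0" "\<And>x. x \<in> carrier_vec n \<Longrightarrow> \<sigma> * vnorm x \<le> vnorm (A *\<^sub>v x)"
    using full_column_rank_bounded_below[OF A A_rank] by blast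
  show thesis
  proof
    show "\<mu> * (\<sigma> / \<beta>)\<^sup>2 > 0" using \<sigma> \<mu>_pos \<beta>_pos by simp
    fix x x' :: "real vec" assume x: "x \<in> carrier_vec n" "x' \<in> carrier_vec n"
    have "\<sigma> * vnorm (x - x') \<le> vnorm (A *\<^sub>v x - A *\<^sub>v x')"
      using \<sigma>(2)[of "x - x'"] x by (simp add: A_diff)
    \<comment> \<open>Since \<open>A *\<^sub>v x\<close> is the gradient of \<open>g\<close> at
      \<open>h x\<close>, the Lipschitz bound for that gradient bounds the variation of
      \<open>h\<close> from below.\<close>
    also have "\<dots> \<le> \<beta> * vnorm (h x - h x')"
      using g(3) x grad_h unfolding lipschitz_gradient_def by (metis h_carrier)
    finally have "\<sigma> / \<beta> * vnorm (x - x') \<le> vnorm (h x - h x')"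
      using \<beta>_pos by (simp add: field_simps)
    then have "(\<sigma> / \<beta> * vnorm (x - x'))\<^sup>2 \<le> (vnorm (h x - h x'))\<^sup>2"
      using \<sigma>(1) \<beta>_pos by (intro power_mono) auto
    then have "\<mu> * (\<sigma> / \<beta> * vnorm (x - x'))\<^sup>2 \<le> \<mu> * (vnorm (h x - h x'))\<^sup>2"
      using \<mu>_pos by simp
    also have "\<dots> \<le> (A *\<^sub>v x - A *\<^sub>v x') \<bullet> (h x - h x')"
      by (rule h_strongly_monotone[OF x])
    also have "\<dots> = (transpose_mat A *\<^sub>v (h x - h x')) \<bullet> (x - x')"
      using x comm_scalar_prod[of "A *\<^sub>v x - A *\<^sub>v x'" m "h x - h x'"]
      by (simp add: At_scalar_prod A_diff)
    also have "\<dots> \<le> (grad n f x - grad n f x') \<bullet> (x - x') + (transpose_mat A *\<^sub>v (h x - h x')) \<bullet> (x - x')"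
      using grad_strongly_monotone[OF f(1,2) order_refl x] by simp
    also have "\<dots> = (F x - F x') \<bullet> (x - x')"
      unfolding F_diff[OF x] using x by (intro add_scalar_prod_distrib[symmetric, of _ n]) auto
    finally show "\<mu> * (\<sigma> / \<beta>)\<^sup>2 * (vnorm (x - x'))\<^sup>2 \<le> (F x - F x') \<bullet> (x - x')"
      by (simp only: power_mult_distrib mult.assoc)
  qed
qed

text \<open>With monotonicity constant c and Lipschitz constant L, expanding the square gives the
  factor 1 - 2 \<eta> c + \<eta>^2 L^2, which is at most 1 - \<eta> c for \<eta> \<le> c / L^2. Then
  1 - s \<le> (1 - s/2)^2 halves the constant. All smaller steps are covered because the algorithm
  has to shrink \<eta> further.\<close>

lemma F_step_contraction:
  obtains c \<eta>0 where "c > 0" "\<eta>0 > 0"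
    "\<And>\<eta>. 0 < \<eta> \<Longrightarrow> \<eta> \<le> \<eta>0 \<Longrightarrow> \<eta> * c < 1"
    "\<And>\<eta> x x'. 0 < \<eta> \<Longrightarrow> \<eta> \<le> \<eta>0 \<Longrightarrow> x \<in> carrier_vec n \<Longrightarrow> x' \<in> carrier_vec n \<Longrightarrow>
       vnorm ((x - x') - \<eta> \<cdot>\<^sub>v (F x - F x')) \<le> (1 - \<eta> * c) * vnorm (x - x')"
proof -
  obtain c where c: "c > 0" "\<And>x x'. x \<in> carrier_vec n \<Longrightarrow> x' \<in> carrier_vec n \<Longrightarrow>
       c * (vnorm (x - x'))\<^sup>2 \<le> (F x - F x') \<bullet> (x - x')"
    using F_strongly_monotone by blast
  obtain L where L: "L > 0" "\<And>x x'. x \<in> carrier_vec n \<Longrightarrow> x' \<in> carrier_vec n \<Longrightarrow>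
       vnorm (F x - F x') \<le> L * vnorm (x - x')"
    using F_lipschitz by blast
  \<comment> \<open>The bound \<open>1 / c\<close> keeps the contraction factor positive, as needed
    to compare squares.\<close>
  define \<eta>0 where "\<eta>0 = min (c / L\<^sup>2) (1 / c)"
  show thesis
  proof
    show "c / 2 > 0" "\<eta>0 > 0" using c(1) L(1) by (auto simp: \<eta>0_def)
    show small: "\<eta> * (c / 2) < 1" if "0 < \<eta>" "\<eta> \<le> \<eta>0" for \<eta>
    proof -
      have "\<eta> * c \<le> 1" using that c(1) by (simp add: \<eta>0_def field_simps)
      then show ?thesis by simp
    qed
    fix \<eta> and x x' :: "real vec"
    assume \<eta>: "0 < \<eta>" "\<eta> \<le> \<eta>0" and x: "x \<in> carrier_vec n" "x' \<in> carrier_vec n"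
    let ?N = "vnorm (x - x')"
    show "vnorm ((x - x') - \<eta> \<cdot>\<^sub>v (F x - F x')) \<le> (1 - \<eta> * (c / 2)) * ?N"
    proof (rule power2_le_imp_le)
      have "(vnorm (F x - F x'))\<^sup>2 \<le> (L * ?N)\<^sup>2"
        using L(2)[OF x] by (intro power_mono) auto
      then have "\<eta>\<^sup>2 * (vnorm (F x - F x'))\<^sup>2 \<le> \<eta> * ((\<eta> * L\<^sup>2) * ?N\<^sup>2)"
        using \<eta>(1) by (simp add: power2_eq_square mult_ac)
      also have "\<dots> \<le> \<eta> * (c * ?N\<^sup>2)"
        using \<eta> L(1) by (intro mult_left_mono mult_right_mono) (auto simp: \<eta>0_def field_simps)
      finally have "\<eta>\<^sup>2 * (vnorm (F x - F x'))\<^sup>2 \<le> \<eta> * (c * ?N\<^sup>2)" .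
      moreover have "\<eta> * (c * ?N\<^sup>2) \<le> \<eta> * ((F x - F x') \<bullet> (x - x'))"
        using c(2)[OF x] \<eta>(1) by simp
      ultimately have "(vnorm ((x - x') - \<eta> \<cdot>\<^sub>v (F x - F x')))\<^sup>2 \<le> (1 - \<eta> * c) * ?N\<^sup>2"
        using x by (simp add: vnorm_diff_smult_power2[of _ n] algebra_simps)
      also have "\<dots> \<le> (1 - \<eta> * (c / 2))\<^sup>2 * ?N\<^sup>2"
        by (intro mult_right_mono) (simp_all add: power2_diff)
      finally show "(vnorm ((x - x') - \<eta> \<cdot>\<^sub>v (F x - F x')))\<^sup>2 \<le> ((1 - \<eta> * (c / 2)) * ?N)\<^sup>2"
        by (simp add: power_mult_distrib)
      show "0 \<le> (1 - \<eta> * (c / 2)) * ?N"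
        using small[OF \<eta>] by (intro mult_nonneg_nonneg) auto
    qed
  qed
qed

text \<open>Zeros of \<open>F\<close> are the fixed points of the gradient step, which is a
  contraction for an admissible \<eta>.\<close>

lemma equilibrium_exists: "\<exists>x\<in>carrier_vec n. F x = 0\<^sub>v n"
proof -
  obtain c \<eta> where c: "c > 0" and \<eta>: "\<eta> > 0" "\<eta> * c < 1"
    and contr: "\<And>x x'. x \<in> carrier_vec n \<Longrightarrow> x' \<in> carrier_vec n \<Longrightarrow>
       vnorm ((x - x') - \<eta> \<cdot>\<^sub>v (F x - F x')) \<le> (1 - \<eta> * c) * vnorm (x - x')"
    using F_step_contraction by (metis order_refl)
  define T where "T x = x - \<eta> \<cdot>\<^sub>v F x" for x
  have T: "T x \<in> carrier_vec n" if "x \<in> carrier_vec n" for x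
    using that by (simp add: T_def)
  have "vnorm (T x - T x') \<le> (1 - \<eta> * c) * vnorm (x - x')"
    if x: "x \<in> carrier_vec n" "x' \<in> carrier_vec n" for x x'
  proof -
    have "T x - T x' = (x - x') - \<eta> \<cdot>\<^sub>v (F x - F x')"
      unfolding T_def using x by (intro diff_of_steps[of _ n]) auto
    then show ?thesis
      using contr[OF x] by simp
  qed
  then obtain x where x: "x \<in> carrier_vec n" "T x = x"
    using contraction_has_fixpoint[of n T "1 - \<eta> * c"] T c \<eta> by auto
  have "F x = 0\<^sub>v n"
  proof (intro eq_vecI)
    show "dim_vec (F x) = dim_vec (0\<^sub>v n)"
      using carrier_vecD[OF F_carrier[OF x(1)]] by simp
    fix i assume "i < dim_vec (0\<^sub>v n)"
    then have i: "i < n" by simp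
    have "T x $ i = x $ i"
      using x(2) by simp
    then show "F x $ i = 0\<^sub>v n $ i"
      using i x(1) \<eta> unfolding T_def by (simp add: carrier_vecD[OF F_carrier[OF x(1)]])
  qed
  with x(1) show ?thesis by blast
qed

section \<open>The saddle point and uniqueness of the optimal solutions\<close>

lemma saddle_inner_max:
  assumes x: "x \<in> carrier_vec n" and y: "y \<in> carrier_vec m"
  shows "saddle f g A x y + \<mu> / 2 * (vnorm (y - h x))\<^sup>2 \<le> saddle f g A x (h x)"
proof -
  \<comment> \<open>The linear term in y makes \<open>h x\<close> a stationary point; the quadratic
    term is kept because it makes the maximiser unique.\<close>
  have "g (h x) + (A *\<^sub>v x) \<bullet> (y - h x) + \<mu> / 2 * (vnorm (y - h x))\<^sup>2 \<le> g y"
    using strongly_convex_first_order[OF g(1,2) _ y h_carrier[OF x]] \<mu>_pos grad_h[OF x] by simp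
  moreover have "(A *\<^sub>v x) \<bullet> (y - h x) = y \<bullet> (A *\<^sub>v x) - h x \<bullet> (A *\<^sub>v x)"
    using x y comm_scalar_prod[of "A *\<^sub>v x" m y] comm_scalar_prod[of "A *\<^sub>v x" m "h x"]
    by (simp add: scalar_prod_minus_distrib[of _ m])
  ultimately show ?thesis
    by (simp add: saddle_def)
qed

text \<open>The equation \<open>F xs = 0\<^sub>v n\<close> says that \<open>xs\<close> is stationary
  for the convex function L(x, h xs) of x.\<close>

lemma saddle_outer_min:
  assumes xs: "xs \<in> carrier_vec n" "F xs = 0\<^sub>v n" and x: "x \<in> carrier_vec n"
  shows "saddle f g A xs (h xs) \<le> saddle f g A x (h xs)"
proof -
  have "f xs + grad n f xs \<bullet> (x - xs) \<le> f x"
    using strongly_convex_first_order[OF f(1,2) _ x xs(1)] by simp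
  moreover have "0 = grad n f xs \<bullet> (x - xs) + (transpose_mat A *\<^sub>v h xs) \<bullet> (x - xs)"
    using xs x add_scalar_prod_distrib[of "grad n f xs" n "transpose_mat A *\<^sub>v h xs" "x - xs"]
    by (simp add: F_def)
  moreover have "(transpose_mat A *\<^sub>v h xs) \<bullet> (x - xs) = h xs \<bullet> (A *\<^sub>v x) - h xs \<bullet> (A *\<^sub>v xs)"
    using xs(1) x by (simp add: At_scalar_prod A_diff scalar_prod_minus_distrib[of _ m])
  ultimately show ?thesis
    by (simp add: saddle_def)
qed

lemma h_eq_of_saddle_le:
  assumes "x \<in> carrier_vec n" "y \<in> carrier_vec m" "saddle f g A x (h x) \<le> saddle f g A x y"
  shows "y = h x"
proof -
  have "\<mu> / 2 * (vnorm (y - h x))\<^sup>2 \<le> 0"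
    using saddle_inner_max[OF assms(1,2)] assms(3) by linarith
  then have "vnorm (y - h x) = 0"
    using \<mu>_pos by (simp add: mult_le_0_iff)
  then show ?thesis
    using assms by (simp add: vnorm_diff_eq_0[of _ m])
qed

text \<open>\<open>h x\<close> determines \<open>A *\<^sub>v x\<close> as the gradient of
  \<open>g\<close> there, and \<open>A\<close> is injective.\<close>

lemma h_inj:
  assumes "x \<in> carrier_vec n" "x' \<in> carrier_vec n" "h x = h x'"
  shows "x = x'"
proof -
  obtain \<sigma> where \<sigma>: "\<sigma> > 0" "\<And>x. x \<in> carrier_vec n \<Longrightarrow> \<sigma> * vnorm x \<le> vnorm (A *\<^sub>v x)"
    using full_column_rank_bounded_below[OF A A_rank] by blast
  have "A *\<^sub>v (x - x') = 0\<^sub>v m"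
    using assms grad_h by (metis A_diff A_carrier minus_cancel_vec)
  then have "vnorm (x - x') = 0"
    using \<sigma>(1) \<sigma>(2)[of "x - x'"] assms vnorm_nonneg[of "x - x'"]
    by (simp add: mult_le_0_iff)
  then show ?thesis
    using assms by (simp add: vnorm_diff_eq_0[of _ n])
qed

text \<open>With s the saddle value, p(xs) \<le> s \<le> p(x). For an optimal x, L(x, h x) \<le>
  p(x) \<le> s \<le> L(x, h xs), so \<open>h xs\<close> also maximises L(x, y) over y. It therefore
  equals \<open>h x\<close>, and \<open>h\<close> is injective.\<close>

lemma primal_opt_iff:
  assumes xs: "xs \<in> carrier_vec n" "F xs = 0\<^sub>v n"
  shows "primal_opt n m f g A x \<longleftrightarrow> x = xs"
proof -
  let ?s = "saddle f g A xs (h xs)"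
  have ub: "primal_fun m f g A xs \<le> ereal ?s"
    unfolding primal_fun_def
  proof (rule SUP_least)
    fix y :: "real vec" assume "y \<in> carrier_vec m"
    then have "saddle f g A xs y + \<mu> / 2 * (vnorm (y - h xs))\<^sup>2 \<le> ?s"
      using saddle_inner_max xs by simp
    moreover have "0 \<le> \<mu> / 2 * (vnorm (y - h xs))\<^sup>2"
      using \<mu>_pos by simp
    ultimately show "ereal (saddle f g A xs y) \<le> ereal ?s"
      by simp
  qed
  have ge: "ereal (saddle f g A x y) \<le> primal_fun m f g A x" if "y \<in> carrier_vec m" for x y
    unfolding primal_fun_def using that by (intro SUP_upper)
  have lb: "ereal ?s \<le> primal_fun m f g A x" if "x \<in> carrier_vec n" for x
    using saddle_outer_min[OF xs that] ge[OF h_carrier[OF xs(1)], of x]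
    by (meson ereal_less_eq(3) order_trans)
  show ?thesis
  proof
    assume "primal_opt n m f g A x"
    then have x: "x \<in> carrier_vec n" "\<not> primal_fun m f g A xs < primal_fun m f g A x"
      using xs by (auto simp: primal_opt_def is_arg_min_def)
    then have "ereal (saddle f g A x (h x)) \<le> ereal ?s"
      using ge[OF h_carrier[OF x(1)], of x] ub by (meson not_less order_trans)
    then have "saddle f g A x (h x) \<le> saddle f g A x (h xs)"
      using saddle_outer_min[OF xs x(1)] by simp
    then have "h xs = h x"
      using x(1) xs(1) by (intro h_eq_of_saddle_le) auto
    then show "x = xs"
      using h_inj x(1) xs(1) by simp
  next
    assume "x = xs"
    then show "primal_opt n m f g A x"
      using xs ub lb by (force simp: primal_opt_def is_arg_min_def not_less intro: order_trans)
  qed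
qed

text \<open>An optimal y satisfies s \<le> d(y) \<le> L(xs, y) for the saddle value s, and L(xs, y)
  attains s only at \<open>h xs\<close>.\<close>

lemma dual_opt_iff:
  assumes xs: "xs \<in> carrier_vec n" "F xs = 0\<^sub>v n"
  shows "dual_opt n m f g A y \<longleftrightarrow> y = h xs"
proof -
  let ?s = "saddle f g A xs (h xs)"
  have lb: "ereal ?s \<le> dual_fun n f g A (h xs)"
    unfolding dual_fun_def using saddle_outer_min[OF xs] by (intro INF_greatest) simp
  have le: "dual_fun n f g A y \<le> ereal (saddle f g A xs y)" for y
    unfolding dual_fun_def using xs(1) by (intro INF_lower)
  have ub: "dual_fun n f g A y \<le> ereal ?s" if "y \<in> carrier_vec m" for y
  proof -
    have "0 \<le> \<mu> / 2 * (vnorm (y - h xs))\<^sup>2"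
      using \<mu>_pos by simp
    then have "saddle f g A xs y \<le> ?s"
      using saddle_inner_max[OF xs(1) that] by linarith
    then show ?thesis
      using le[of y] by (meson ereal_less_eq(3) order_trans)
  qed
  show ?thesis
  proof
    assume "dual_opt n m f g A y"
    then have y: "y \<in> carrier_vec m" "\<not> dual_fun n f g A (h xs) < dual_fun n f g A y"
      "\<not> dual_fun n f g A y < dual_fun n f g A (h xs)"
      using xs lb ub by (force simp: dual_opt_def is_arg_max_def)+
    then have "ereal ?s \<le> ereal (saddle f g A xs y)"
      using lb le[of y] by (meson not_less order_trans)
    then show "y = h xs"
      using y(1) xs(1) by (intro h_eq_of_saddle_le) auto
  next
    assume "y = h xs"
    then show "dual_opt n m f g A y"
      using xs ub lb by (force simp: dual_opt_def is_arg_max_def not_less intro: order_trans)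
  qed
qed

section \<open>Convergence of the two-time-scale iteration\<close>

lemma fast_step:
  assumes \<gamma>: "0 \<le> \<gamma>" "5 * \<gamma> \<le> 1"
    and x: "x \<in> carrier_vec n" and y: "y \<in> carrier_vec m" and v: "v \<in> carrier_vec m"
    and y': "y' = v - (1 / \<beta>) \<cdot>\<^sub>v (grad m g v - A *\<^sub>v x)"
    and v': "v' = (1 + \<gamma>) \<cdot>\<^sub>v y' - \<gamma> \<cdot>\<^sub>v y"
  shows "max (vnorm (y' - h x)) (vnorm (v' - h x)) \<le> 4 / 5 * max (vnorm (y - h x)) (vnorm (v - h x))"
proof -
  have y'_carrier: "y' \<in> carrier_vec m"
    using x v by (simp add: y')
  have "y' - h x = (v - h x) - (1 / \<beta>) \<cdot>\<^sub>v (grad m g v - grad m g (h x))"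
    unfolding y' grad_h[OF x] using x v by (intro diff_right_commute_vec[of _ m]) auto
  then have y'_le: "vnorm (y' - h x) \<le> 1 / 2 * vnorm (v - h x)"
    using gradient_step_half_lipschitz[OF v h_carrier[OF x]] by simp
  \<comment> \<open>The coefficients 1 + \<gamma> and -\<gamma> sum to 1, so \<open>h x\<close> may
    be subtracted from both points.\<close>
  have "v' - h x = (1 + \<gamma>) \<cdot>\<^sub>v (y' - h x) - \<gamma> \<cdot>\<^sub>v (y - h x)"
    unfolding v' using y y'_carrier h_carrier[OF x] by (intro eq_vecI) (auto simp: algebra_simps)
  then have "vnorm (v' - h x) \<le> (1 + \<gamma>) * vnorm (y' - h x) + \<gamma> * vnorm (y - h x)"
    using vnorm_diff_le[of "(1 + \<gamma>) \<cdot>\<^sub>v (y' - h x)" m "\<gamma> \<cdot>\<^sub>v (y - h x)"] \<gamma> x y y'_carrier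
    by (simp add: vnorm_smult)
  \<comment> \<open>From \<gamma> \<le> 1/5; the two weights 6/5 * 1/2 and 1/5 add up to the rate
    4/5.\<close>
  also have "\<dots> \<le> 6 / 5 * (1 / 2 * vnorm (v - h x)) + 1 / 5 * vnorm (y - h x)"
    using \<gamma> y'_le by (intro add_mono mult_mono) auto
  finally have v'_le: "vnorm (v' - h x) \<le> 6 / 5 * (1 / 2 * vnorm (v - h x)) + 1 / 5 * vnorm (y - h x)" .
  have "vnorm (v - h x) \<le> max (vnorm (y - h x)) (vnorm (v - h x))"
    and "vnorm (y - h x) \<le> max (vnorm (y - h x)) (vnorm (v - h x))"
    by auto
  then show ?thesis
    using y'_le v'_le vnorm_nonneg[of "v - h x"] by (intro max.boundedI) linarith+
qed

text \<open>Lyapunov function: the distance of \<open>x\<close> to the solution plus a multiple \<open>w\<close> of the tracking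
  error of \<open>(y, v)\<close>. The weight \<open>w\<close> is chosen so that the drift of \<open>h x\<close> costs at most half of the
  decrease \<open>\<eta> * c\<close> of the slow part, and then \<open>\<eta>\<close> so that the tracking error still decreases.\<close>

lemma algorithm_converges:
  assumes \<gamma>: "0 \<le> \<gamma>" "5 * \<gamma> \<le> 1" and xs: "xs \<in> carrier_vec n" "F xs = 0\<^sub>v n"
  shows "\<exists>\<eta>>0. \<forall>x y v.
           x 0 \<in> carrier_vec n \<longrightarrow> y 0 \<in> carrier_vec m \<longrightarrow> v 0 \<in> carrier_vec m \<longrightarrow>
           (\<forall>k::nat.
              x (Suc k) = x k - \<eta> \<cdot>\<^sub>v (grad n f (x k) + transpose_mat A *\<^sub>v y k) \<and>
              y (Suc k) = v k - (1 / \<beta>) \<cdot>\<^sub>v (grad m g (v k) - A *\<^sub>v x k) \<and>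
              v (Suc k) = (1 + \<gamma>) \<cdot>\<^sub>v y (Suc k) - \<gamma> \<cdot>\<^sub>v y k) \<longrightarrow>
           converges_exponentially x xs \<and> converges_exponentially y (h xs)"
proof -
  obtain a where a: "a > 0" "\<And>y. y \<in> carrier_vec m \<Longrightarrow> vnorm (transpose_mat A *\<^sub>v y) \<le> a * vnorm y"
    using mult_mat_vec_bounded[of "transpose_mat A" n m] A by auto
  obtain l where l: "l > 0"
    "\<And>x x'. x \<in> carrier_vec n \<Longrightarrow> x' \<in> carrier_vec n \<Longrightarrow> vnorm (h x - h x') \<le> l * vnorm (x - x')"
    using h_lipschitz by blast
  obtain L where L: "L > 0" "\<And>x x'. x \<in> carrier_vec n \<Longrightarrow> x' \<in> carrier_vec n \<Longrightarrow>
       vnorm (F x - F x') \<le> L * vnorm (x - x')"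
    using F_lipschitz by blast
  obtain c \<eta>0 where c: "c > 0" and \<eta>0: "\<eta>0 > 0"
    and small: "\<And>\<eta>. 0 < \<eta> \<Longrightarrow> \<eta> \<le> \<eta>0 \<Longrightarrow> \<eta> * c < 1"
    and contr: "\<And>\<eta> x x'. 0 < \<eta> \<Longrightarrow> \<eta> \<le> \<eta>0 \<Longrightarrow> x \<in> carrier_vec n \<Longrightarrow> x' \<in> carrier_vec n \<Longrightarrow>
       vnorm ((x - x') - \<eta> \<cdot>\<^sub>v (F x - F x')) \<le> (1 - \<eta> * c) * vnorm (x - x')"
    using F_step_contraction by metis
  define w where "w = c / (2 * l * L)"
  define \<eta> where "\<eta> = min \<eta>0 (w / (10 * a * (1 + w * l)))"
  \<comment> \<open>The first entry is the slow rate after paying for the drift. The second is the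
    fast rate 4/5 plus a margin of 1/10 for the terms of order \<eta>, which the choice of \<eta>
    keeps below \<open>w / 10\<close>.\<close>
  define \<rho> where "\<rho> = max (1 - \<eta> * c / 2) (9 / 10)"
  have w: "w > 0"
    using c l(1) L(1) by (simp add: w_def)
  have denom: "0 < 10 * a * (1 + w * l)"
    using a(1) w l(1) by (simp add: add_pos_pos)
  then have \<eta>: "0 < \<eta>" "\<eta> \<le> \<eta>0" "\<eta> \<le> w / (10 * a * (1 + w * l))"
    using \<eta>0 w by (auto simp: \<eta>_def)
  from \<eta>(3) have \<eta>w: "10 * (\<eta> * a + w * (l * \<eta> * a)) \<le> w"
    using denom by (simp add: pos_le_divide_eq algebra_simps)
  have wlL: "w * (l * \<eta> * L) = \<eta> * c / 2"
    using l(1) L(1) by (simp add: w_def)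
  have \<rho>: "0 \<le> \<rho>" "\<rho> < 1"
    using \<eta>(1) c by (auto simp: \<rho>_def)
  show ?thesis
  proof (intro exI[of _ \<eta>] conjI allI impI)
    show "0 < \<eta>" by fact
    fix x y v :: "nat \<Rightarrow> real vec"
    assume init: "x 0 \<in> carrier_vec n" "y 0 \<in> carrier_vec m" "v 0 \<in> carrier_vec m"
      and rec: "\<forall>k. x (Suc k) = x k - \<eta> \<cdot>\<^sub>v (grad n f (x k) + transpose_mat A *\<^sub>v y k) \<and>
              y (Suc k) = v k - (1 / \<beta>) \<cdot>\<^sub>v (grad m g (v k) - A *\<^sub>v x k) \<and>
              v (Suc k) = (1 + \<gamma>) \<cdot>\<^sub>v y (Suc k) - \<gamma> \<cdot>\<^sub>v y k"
    have "x k \<in> carrier_vec n \<and> y k \<in> carrier_vec m \<and> v k \<in> carrier_vec m" for k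
    proof (induction k)
      case (Suc k)
      then show ?case
        using rec[rule_format, of k] by (metis A_carrier At_carrier add_carrier_vec grad_f_carrier
            grad_g_carrier minus_carrier_vec smult_carrier_vec)
    qed (simp add: init)
    then have C: "x k \<in> carrier_vec n" "y k \<in> carrier_vec m" "v k \<in> carrier_vec m" for k
      by auto
    define d where "d k = vnorm (x k - xs)" for k
    define e where "e k = max (vnorm (y k - h (x k))) (vnorm (v k - h (x k)))" for k
    have nonneg: "0 \<le> d k" "0 \<le> e k" for k
      by (auto simp: d_def e_def le_max_iff_disj)
    have step: "d (Suc k) + w * e (Suc k) \<le> \<rho> * (d k + w * e k)" for k
    proof -
      \<comment> \<open>The algorithm steps with \<open>y k\<close> in place of
        \<open>h (x k)\<close>; \<open>b\<close> is the resulting error in the gradient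
        \<open>F (x k)\<close>.\<close>
      define b where "b = transpose_mat A *\<^sub>v (y k - h (x k))"
      have b: "b \<in> carrier_vec n"
        using C by (simp add: b_def)
      have "vnorm b \<le> a * vnorm (y k - h (x k))"
        unfolding b_def using C by (intro a(2)) auto
      also have "\<dots> \<le> a * e k"
        using a(1) by (intro mult_left_mono) (auto simp: e_def)
      finally have b_le: "vnorm b \<le> a * e k" .
      have "grad n f (x k) + transpose_mat A *\<^sub>v y k = F (x k) + b"
        unfolding F_def b_def At_diff[OF C(2) h_carrier[OF C(1)]]
        using grad_f_carrier[OF C(1)] At_carrier[OF C(2)] At_carrier[OF h_carrier[OF C(1)]]
        by (intro add_add_diff_vec)
      then have x_Suc: "x (Suc k) = x k - \<eta> \<cdot>\<^sub>v (F (x k) + b)"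
        using rec by simp
      have "x (Suc k) - xs = ((x k - xs) - \<eta> \<cdot>\<^sub>v (F (x k) - F xs)) - \<eta> \<cdot>\<^sub>v b"
        unfolding x_Suc xs(2) using C(1)[of k] F_carrier[OF C(1)] xs(1) b
        by (intro perturbed_step_diff)
      then have "d (Suc k) \<le> vnorm ((x k - xs) - \<eta> \<cdot>\<^sub>v (F (x k) - F xs)) + \<eta> * vnorm b"
        using vnorm_diff_le[of "(x k - xs) - \<eta> \<cdot>\<^sub>v (F (x k) - F xs)" n "\<eta> \<cdot>\<^sub>v b"] C xs(1) b \<eta>(1)
        by (simp add: d_def vnorm_smult)
      also have "\<dots> \<le> (1 - \<eta> * c) * d k + \<eta> * (a * e k)"
        unfolding d_def using contr[OF \<eta>(1,2) C(1) xs(1)] b_le \<eta>(1)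
        by (intro add_mono mult_left_mono) auto
      finally have d_Suc: "d (Suc k) \<le> (1 - \<eta> * c) * d k + \<eta> * (a * e k)" .
      \<comment> \<open>The length of the move in x governs how far the target
        \<open>h (x k)\<close> drifts. As \<open>F\<close> vanishes at \<open>xs\<close>, its
        Lipschitz bound gives \<open>vnorm (F (x k)) \<le> L * d k\<close>.\<close>
      have "vnorm (x k - x (Suc k)) = \<eta> * vnorm (F (x k) + b)"
        unfolding x_Suc using C(1)[of k] F_carrier[OF C(1), of k] b \<eta>(1)
        by (subst diff_diff_step_vec[of _ n]) (auto simp: vnorm_smult)
      also have "\<dots> \<le> \<eta> * (L * d k + a * e k)"
        using vnorm_add_le[of "F (x k)" n b] L(2)[OF C(1) xs(1), of k] b b_le C \<eta>(1)
        by (intro mult_left_mono) (auto simp: d_def xs(2) minus_zero_vec[OF F_carrier[OF C(1)]])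
      finally have "l * vnorm (x k - x (Suc k)) \<le> l * (\<eta> * (L * d k + a * e k))"
        using l(1) by (intro mult_left_mono) auto
      then have drift: "vnorm (h (x k) - h (x (Suc k))) \<le> l * (\<eta> * (L * d k + a * e k))"
        using l(2)[OF C(1) C(1), of k "Suc k"] by linarith
      \<comment> \<open>This contraction is towards the old target \<open>h (x k)\<close>; the
        triangle inequality then passes to \<open>h (x (Suc k))\<close> at the cost of the
        drift.\<close>
      have "max (vnorm (y (Suc k) - h (x k))) (vnorm (v (Suc k) - h (x k))) \<le> 4 / 5 * e k"
        unfolding e_def using rec C by (intro fast_step[OF \<gamma>]) auto
      then have "e (Suc k) \<le> 4 / 5 * e k + l * (\<eta> * (L * d k + a * e k))"
        using drift vnorm_triangle[OF C(2)[of "Suc k"] h_carrier[OF C(1)[of k]] h_carrier[OF C(1)[of "Suc k"]]]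
          vnorm_triangle[OF C(3)[of "Suc k"] h_carrier[OF C(1)[of k]] h_carrier[OF C(1)[of "Suc k"]]]
        unfolding e_def[of "Suc k"] by auto
      then have "w * e (Suc k) \<le> w * (4 / 5 * e k + l * (\<eta> * (L * d k + a * e k)))"
        using w by (intro mult_left_mono) auto
      \<comment> \<open>Collecting the coefficients of \<open>d k\<close> and \<open>e k\<close>
        leaves two scalar inequalities.\<close>
      then have "d (Suc k) + w * e (Suc k) \<le>
          (1 - \<eta> * c + w * (l * \<eta> * L)) * d k + (\<eta> * a + w * (l * \<eta> * a) + 4 / 5 * w) * e k"
        using d_Suc by (simp add: algebra_simps)
      also have "\<dots> \<le> \<rho> * d k + (\<rho> * w) * e k"
      proof (intro add_mono mult_right_mono nonneg)
        show "1 - \<eta> * c + w * (l * \<eta> * L) \<le> \<rho>"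
          unfolding wlL by (simp add: \<rho>_def)
        have "\<eta> * a + w * (l * \<eta> * a) + 4 / 5 * w \<le> 9 / 10 * w"
          using \<eta>w by simp
        also have "\<dots> \<le> \<rho> * w"
          using w by (intro mult_right_mono) (auto simp: \<rho>_def)
        finally show "\<eta> * a + w * (l * \<eta> * a) + 4 / 5 * w \<le> \<rho> * w" .
      qed
      finally show ?thesis
        by (simp add: algebra_simps)
    qed
    define V where "V = d 0 + w * e 0"
    have V: "0 \<le> V"
      using nonneg w by (simp add: V_def)
    have bound: "d k + w * e k \<le> V * \<rho> ^ k" for k
    proof (induction k)
      case (Suc k)
      have "\<rho> * (d k + w * e k) \<le> \<rho> * (V * \<rho> ^ k)"
        using Suc \<rho>(1) by (rule mult_left_mono)
      with step[of k] show ?case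
        by (simp add: mult_ac)
    qed (simp add: V_def)
    have d_bound: "d k \<le> V * \<rho> ^ k" and e_bound: "e k \<le> V / w * \<rho> ^ k" for k
    proof -
      show "d k \<le> V * \<rho> ^ k"
        using bound[of k] mult_nonneg_nonneg[OF less_imp_le[OF w] nonneg(2)[of k]] by linarith
      have "w * e k \<le> V * \<rho> ^ k"
        using bound[of k] nonneg(1)[of k] by linarith
      then show "e k \<le> V / w * \<rho> ^ k"
        using w by (simp add: field_simps)
    qed
    show "converges_exponentially x xs"
      unfolding converges_exponentially_def using V \<rho> d_bound by (auto simp: d_def)
    \<comment> \<open>\<open>y k\<close> tracks a moving target, so the distance of that target from
      \<open>h xs\<close> is added to the tracking error.\<close>
    have "vnorm (y k - h xs) \<le> (V / w + l * V) * \<rho> ^ k" for k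
    proof -
      have "vnorm (y k - h xs) \<le> vnorm (y k - h (x k)) + vnorm (h (x k) - h xs)"
        using C xs by (intro vnorm_triangle) auto
      also have "\<dots> \<le> e k + l * d k"
        unfolding d_def e_def using l(2)[OF C(1) xs(1)] by (intro add_mono) auto
      also have "\<dots> \<le> V / w * \<rho> ^ k + l * (V * \<rho> ^ k)"
        using e_bound d_bound l(1) by (intro add_mono mult_left_mono) auto
      finally show ?thesis
        by (simp add: algebra_simps)
    qed
    then show "converges_exponentially y (h xs)"
      unfolding converges_exponentially_def using V \<rho> w l(1)
      by (intro exI[of _ "V / w + l * V"] exI[of _ \<rho>]) auto
  qed
qed

end

section \<open>The momentum parameter and the choice of the constant\<close>

lemma momentum_bounds:
  fixes \<mu> \<beta> :: real
  assumes "0 < \<mu>" "\<mu> \<le> \<beta>" "7 * \<beta> \<le> 8 * \<mu>"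
  shows "0 \<le> (sqrt \<beta> - sqrt \<mu>) / (sqrt \<beta> + sqrt \<mu>)"
    and "5 * ((sqrt \<beta> - sqrt \<mu>) / (sqrt \<beta> + sqrt \<mu>)) \<le> 1"
proof -
  have pos: "0 < sqrt \<beta> + sqrt \<mu>" and le: "sqrt \<mu> \<le> sqrt \<beta>"
    using assms by (auto simp: add_pos_pos)
  \<comment> \<open>3/2 is the ratio of the roots at which \<gamma> is (3/2 - 1) / (3/2 + 1) =
    1/5.\<close>
  have "sqrt \<beta> \<le> sqrt ((3 / 2)\<^sup>2 * \<mu>)"
    using assms by (simp add: power2_eq_square)
  also have "\<dots> = 3 / 2 * sqrt \<mu>"
    by (simp only: real_sqrt_mult real_sqrt_abs)
  finally show "5 * ((sqrt \<beta> - sqrt \<mu>) / (sqrt \<beta> + sqrt \<mu>)) \<le> 1"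
    using pos by (simp add: pos_divide_le_eq)
  show "0 \<le> (sqrt \<beta> - sqrt \<mu>) / (sqrt \<beta> + sqrt \<mu>)"
    using pos le by simp
qed

theorem corollary11:
  shows "\<exists>\<kappa>0::real. \<kappa>0 > 1 \<and>
    (\<forall>(n::nat) (m::nat) (f :: real Matrix.vec \<Rightarrow> real) (g :: real Matrix.vec \<Rightarrow> real)
       (A :: real Matrix.mat) (\<beta>f::real) (\<mu>g::real) (\<beta>g::real).
       0 < \<beta>f \<longrightarrow> f \<in> smooth_convex n 0 \<beta>f \<longrightarrow>
       0 < \<mu>g \<longrightarrow> \<mu>g \<le> \<beta>g \<longrightarrow> \<beta>g / \<mu>g \<le> \<kappa>0 \<longrightarrow> g \<in> smooth_convex m \<mu>g \<beta>g \<longrightarrow>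
       A \<in> carrier_mat m n \<longrightarrow> vec_space.rank m A = n \<longrightarrow>
       (let \<gamma> = (sqrt \<beta>g - sqrt \<mu>g) / (sqrt \<beta>g + sqrt \<mu>g);
            \<eta>2 = 1 / \<beta>g
        in \<exists>xs ys.
             (\<forall>x. primal_opt n m f g A x \<longleftrightarrow> x = xs) \<and>
             (\<forall>y. dual_opt n m f g A y \<longleftrightarrow> y = ys) \<and>
             (\<exists>\<eta>1>0. \<forall>x y v.
                x 0 \<in> carrier_vec n \<longrightarrow> y 0 \<in> carrier_vec m \<longrightarrow> v 0 \<in> carrier_vec m \<longrightarrow>
                (\<forall>k::nat.
                   x (Suc k) = x k - \<eta>1 \<cdot>\<^sub>v (grad n f (x k) + transpose_mat A *\<^sub>v y k) \<and>
                   y (Suc k) = v k - \<eta>2 \<cdot>\<^sub>v (grad m g (v k) - A *\<^sub>v x k) \<and>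
                   v (Suc k) = (1 + \<gamma>) \<cdot>\<^sub>v y (Suc k) - \<gamma> \<cdot>\<^sub>v y k) \<longrightarrow>
                converges_exponentially x xs \<and> converges_exponentially y ys)))"
proof (intro exI[of _ "8 / 7 :: real"] conjI allI impI)
  fix n m :: nat and f g :: "real Matrix.vec \<Rightarrow> real" and A :: "real mat" and \<beta>f \<mu>g \<beta>g :: real
  assume *: "0 < \<beta>f" "f \<in> smooth_convex n 0 \<beta>f" "0 < \<mu>g" "\<mu>g \<le> \<beta>g" "\<beta>g / \<mu>g \<le> 8 / 7"
    "g \<in> smooth_convex m \<mu>g \<beta>g" "A \<in> carrier_mat m n" "vec_space.rank m A = n"
  have \<kappa>: "7 * \<beta>g \<le> 8 * \<mu>g"
    using *(3,5) by (simp add: field_simps)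
  interpret bilinear_saddle n m f g A \<beta>f \<mu>g \<beta>g
    using * \<kappa> by unfold_locales
  \<comment> \<open>\<open>xs\<close> and \<open>h xs\<close> are the two optimal solutions; they do
    not depend on the step size and are fixed before it.\<close>
  obtain xs where xs: "xs \<in> carrier_vec n" "F xs = 0\<^sub>v n"
    using equilibrium_exists by blast
  show "let \<gamma> = (sqrt \<beta>g - sqrt \<mu>g) / (sqrt \<beta>g + sqrt \<mu>g);
            \<eta>2 = 1 / \<beta>g
        in \<exists>xs ys.
             (\<forall>x. primal_opt n m f g A x \<longleftrightarrow> x = xs) \<and>
             (\<forall>y. dual_opt n m f g A y \<longleftrightarrow> y = ys) \<and>
             (\<exists>\<eta>1>0. \<forall>x y v.
                x 0 \<in> carrier_vec n \<longrightarrow> y 0 \<in> carrier_vec m \<longrightarrow> v 0 \<in> carrier_vec m \<longrightarrow>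
                (\<forall>k::nat.
                   x (Suc k) = x k - \<eta>1 \<cdot>\<^sub>v (grad n f (x k) + transpose_mat A *\<^sub>v y k) \<and>
                   y (Suc k) = v k - \<eta>2 \<cdot>\<^sub>v (grad m g (v k) - A *\<^sub>v x k) \<and>
                   v (Suc k) = (1 + \<gamma>) \<cdot>\<^sub>v y (Suc k) - \<gamma> \<cdot>\<^sub>v y k) \<longrightarrow>
                converges_exponentially x xs \<and> converges_exponentially y ys)"
    unfolding Let_def
    using primal_opt_iff[OF xs] dual_opt_iff[OF xs]
      algorithm_converges[OF momentum_bounds[OF *(3,4) \<kappa>] xs]
    by (intro exI[of _ xs] exI[of _ "h xs"] conjI allI)
qed simp

end
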